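(* Let $P,Q\in\mathbb{H}^{n\times n}$ be nontrivial generalized reflection matrices, and let $U=[U_1,\ U_2]$ and $V=[V_1,\ V_2]$ be unitary matrices in $\mathbb{H}^{n\times n}$, with $U_1\in\mathbb{H}^{n\times r_1}$, $U_2\in\mathbb{H}^{n\times(n-r_1)}$, $V_1\in\mathbb{H}^{n\times r_2}$, $V_2\in\mathbb{H}^{n\times(n-r_2)}$, such that $$P=U\begin{bmatrix} I_{r_1}&0\\ 0&-I_{n-r_1}\end{bmatrix}U^*,\qquad Q=V\begin{bmatrix} I_{r_2}&0\\ 0&-I_{n-r_2}\end{bmatrix}V^*.$$ Let $Z\in\mathbb{H}^{n\times m}$ and $\Lambda=\mathrm{diag}(\lambda_1,\dots,\lambda_m)$, where $\lambda_1,\dots,\lambda_m$ are complex numbers with nonnegative imaginary parts. Let $0<l<m$ and suppose that $$Z=[V_2X_1,\ V_1X_2]=[U_1Y_1,\ U_2Y_2],\qquad \Lambda=\begin{bmatrix}\Phi&0\\ 0&\Psi\end{bmatrix},$$ where $X_1\in\mathbb{H}^{(n-r_2)\times l}$, $X_2\in\mathbb{H}^{r_2\times(m-l)}$, $Y_1\in\mathbb{H}^{r_1\times l}$, $Y_2\in\mathbb{H}^{(n-r_1)\times(m-l)}$, $\Phi=\mathrm{diag}(\lambda_1,\dots,\lambda_l)$, $\Psi=\mathrm{diag}(\lambda_{l+1},\dots,\lambda_m)$. Let $$\varphi_2=\{A\in\mathbb{H}_a^{n\times n}(P,Q)\ :\ AZ=Z\Lambda\}$$ and assume $\varphi_2$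 is nonempty. Let $E\in\mathbb{H}^{n\times n}$ be given and write $$\begin{bmatrix}U_1^*\\ U_2^*\end{bmatrix}E\,[V_1,\ V_2]=\begin{bmatrix}E_{11}&E_{12}\\ E_{21}&E_{22}\end{bmatrix},$$ with $E_{11}\in\mathbb{H}^{r_1\times r_2}$, $E_{12}\in\mathbb{H}^{r_1\times(n-r_2)}$, $E_{21}\in\mathbb{H}^{(n-r_1)\times r_2}$, $E_{22}\in\mathbb{H}^{(n-r_1)\times(n-r_2)}$. Then the approximation problem $A_a=\arg\min_{A\in\varphi_2}\|A-E\|_F$ has a unique solution, namely $$A_a=[U_1,\ U_2]\begin{bmatrix}0&Y_1\Phi X_1^{+}+E_{12}R_{X_1}\\ Y_2\Psi X_2^{+}+E_{21}R_{X_2}&0\end{bmatrix}\begin{bmatrix}V_1^*\\ V_2^*\end{bmatrix}.$$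
   Context: $\mathbb{H}$ is the real quaternion algebra, $\mathbb{H}^{m\times n}$ the set of $m\times n$ matrices over $\mathbb{H}$, $^*$ denotes conjugate transpose, and $\|A\|_F$ is the Frobenius norm, the norm generated by the inner product $\langle A,B\rangle=\mathrm{trace}(B^*A)$. A matrix $P\in\mathbb{H}^{n\times n}$ is a nontrivial generalized reflection matrix if $P^*=P\neq I$ and $P^2=I$. $\mathbb{H}_a^{n\times n}(P,Q)=\{A\in\mathbb{H}^{n\times n}: A=-PAQ\}$ is the set of generalized antireflexive matrices with respect to $(P,Q)$. For a matrix $X$, $X^{+}$ denotes an arbitrary but fixed reflexive inverse of $X$ (i.e. $XX^{+}X=X$ and $X^{+}XX^{+}=X^{+}$), and $R_X=I-XX^{+}$.
   Formalization: The displayed formula for A_a is claimed only for reflexive inverses with X_1X_1^+ and X_2X_2^+ Hermitian (e.g. Moore–Penrose), since it fails for arbitrary reflexive inverses; existence and uniqueness of the minimizer are claimed without this condition. *)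

theory Defs
  imports Complex_Main "Jordan_Normal_Form.Matrix"
begin

section \<open>The real quaternion algebra\<close>

datatype quat = Quat (qRe: real) (qI: real) (qJ: real) (qK: real)

lemma quat_eq_iff:
  "p = q \<longleftrightarrow> qRe p = qRe q \<and> qI p = qI q \<and> qJ p = qJ q \<and> qK p = qK q"
  by (cases p; cases q) simp

instantiation quat :: real_div_algebra
begin

definition zero_quat :: quat where "0 = Quat 0 0 0 0"

definition one_quat :: quat where "1 = Quat 1 0 0 0"

definition plus_quat :: "quat \<Rightarrow> quat \<Rightarrow> quat" where
  "p + q = Quat (qRe p + qRe q) (qI p + qI q) (qJ p + qJ q) (qK p + qK q)"

definition uminus_quat :: "quat \<Rightarrow> quat" where
  "- p = Quat (- qRe p) (- qI p) (- qJ p) (- qK p)"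

definition minus_quat :: "quat \<Rightarrow> quat \<Rightarrow> quat" where
  "p - q = Quat (qRe p - qRe q) (qI p - qI q) (qJ p - qJ q) (qK p - qK q)"

definition times_quat :: "quat \<Rightarrow> quat \<Rightarrow> quat" where
  "p * q = Quat
     (qRe p * qRe q - qI p * qI q - qJ p * qJ q - qK p * qK q)
     (qRe p * qI q + qI p * qRe q + qJ p * qK q - qK p * qJ q)
     (qRe p * qJ q - qI p * qK q + qJ p * qRe q + qK p * qI q)
     (qRe p * qK q + qI p * qJ q - qJ p * qI q + qK p * qRe q)"

definition scaleR_quat :: "real \<Rightarrow> quat \<Rightarrow> quat" where
  "scaleR r p = Quat (r * qRe p) (r * qI p) (r * qJ p) (r * qK p)"

definition inverse_quat :: "quat \<Rightarrow> quat" where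
  "inverse p = (let s = (qRe p)\<^sup>2 + (qI p)\<^sup>2 + (qJ p)\<^sup>2 + (qK p)\<^sup>2
     in Quat (qRe p / s) (- qI p / s) (- qJ p / s) (- qK p / s))"

definition divide_quat :: "quat \<Rightarrow> quat \<Rightarrow> quat" where
  "divide_quat p q = p * inverse q"

lemma quat_norm2_pos:
  assumes "p \<noteq> 0"
  shows "(qRe p)\<^sup>2 + (qI p)\<^sup>2 + (qJ p)\<^sup>2 + (qK p)\<^sup>2 > 0"
proof -
  have "(qRe p)\<^sup>2 > 0 \<or> (qI p)\<^sup>2 > 0 \<or> (qJ p)\<^sup>2 > 0 \<or> (qK p)\<^sup>2 > 0"
    using assms by (simp add: quat_eq_iff zero_quat_def)
  moreover have "(qRe p)\<^sup>2 \<ge> 0" "(qI p)\<^sup>2 \<ge> 0" "(qJ p)\<^sup>2 \<ge> 0" "(qK p)\<^sup>2 \<ge> 0"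
    by simp_all
  ultimately show ?thesis by linarith
qed

lemmas quat_defs = zero_quat_def one_quat_def plus_quat_def uminus_quat_def
  minus_quat_def times_quat_def scaleR_quat_def

lemma quat_mult_inverse:
  assumes "(p::quat) \<noteq> 0"
  shows "inverse p * p = 1" "p * inverse p = 1"
proof -
  define s where "s = (qRe p)\<^sup>2 + (qI p)\<^sup>2 + (qJ p)\<^sup>2 + (qK p)\<^sup>2"
  have s: "s > 0" unfolding s_def by (rule quat_norm2_pos[OF assms])
  have inv: "inverse p = Quat (qRe p / s) (- qI p / s) (- qJ p / s) (- qK p / s)"
    by (simp add: inverse_quat_def s_def Let_def)
  have "qRe p * qRe p / s + qI p * qI p / s + qJ p * qJ p / s + qK p * qK p / s = s / s"
    unfolding add_divide_distrib[symmetric] by (simp add: s_def power2_eq_square)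
  with s show "inverse p * p = 1" "p * inverse p = 1"
    unfolding inv by (simp_all add: quat_defs algebra_simps)
qed

instance
proof
  fix p :: quat
  show "p \<noteq> 0 \<Longrightarrow> inverse p * p = 1" "p \<noteq> 0 \<Longrightarrow> p * inverse p = 1"
    by (rule quat_mult_inverse; assumption)+
  show "inverse (0::quat) = 0"
    by (simp add: inverse_quat_def zero_quat_def)
qed (simp_all add: quat_eq_iff quat_defs divide_quat_def algebra_simps)

end

text \<open>Complex numbers are the quaternions with vanishing \<open>j\<close>- and \<open>k\<close>-parts.\<close>

definition quat_of_complex :: "complex \<Rightarrow> quat" where
  "quat_of_complex z = Quat (Re z) (Im z) 0 0"

definition qcnj :: "quat \<Rightarrow> quat" where
  "qcnj p = Quat (qRe p) (- qI p) (- qJ p) (- qK p)"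


section \<open>Quaternion matrices\<close>

definition append_cols :: "'a::zero mat \<Rightarrow> 'a mat \<Rightarrow> 'a mat" where
  "append_cols A B = four_block_mat A B (0\<^sub>m 0 (dim_col A)) (0\<^sub>m 0 (dim_col B))"

definition conj_transpose :: "quat mat \<Rightarrow> quat mat" where
  "conj_transpose A = map_mat qcnj (transpose_mat A)"

definition unitary_quat_mat :: "nat \<Rightarrow> quat mat \<Rightarrow> bool" where
  "unitary_quat_mat n U \<longleftrightarrow> U \<in> carrier_mat n n \<and>
     U * conj_transpose U = 1\<^sub>m n \<and> conj_transpose U * U = 1\<^sub>m n"

definition trace_mat :: "quat mat \<Rightarrow> quat" where
  "trace_mat A = (\<Sum>i<dim_row A. A $$ (i, i))"

definition frob_inner :: "quat mat \<Rightarrow> quat mat \<Rightarrow> quat" where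
  "frob_inner A B = trace_mat (conj_transpose B * A)"

text \<open>\<open>frob_inner A A\<close> is a real quaternion (lemma \<open>frob_inner_self\<close> below), so taking the real
  part loses nothing.\<close>

definition frob_norm :: "quat mat \<Rightarrow> real" where
  "frob_norm A = sqrt (qRe (frob_inner A A))"

lemma qRe_sum: "qRe (sum f S) = (\<Sum>x\<in>S. qRe (f x))"
  by (induction S rule: infinite_finite_induct) (simp_all add: zero_quat_def plus_quat_def)

lemma of_real_quat: "(of_real r :: quat) = Quat r 0 0 0"
  by (simp add: of_real_def scaleR_quat_def one_quat_def)

lemma frob_inner_self:
  "frob_inner A A = of_real (\<Sum>j<dim_col A. \<Sum>i<dim_row A.
     (qRe (A $$ (i, j)))\<^sup>2 + (qI (A $$ (i, j)))\<^sup>2 + (qJ (A $$ (i, j)))\<^sup>2 + (qK (A $$ (i, j)))\<^sup>2)"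
proof -
  have "qcnj p * p = of_real ((qRe p)\<^sup>2 + (qI p)\<^sup>2 + (qJ p)\<^sup>2 + (qK p)\<^sup>2)" for p
    unfolding of_real_quat by (simp add: qcnj_def times_quat_def power2_eq_square)
  then show ?thesis
    by (simp add: frob_inner_def trace_mat_def conj_transpose_def scalar_prod_def atLeast0LessThan)
qed

definition nontrivial_gen_reflection :: "nat \<Rightarrow> quat mat \<Rightarrow> bool" where
  "nontrivial_gen_reflection n P \<longleftrightarrow> P \<in> carrier_mat n n \<and>
     conj_transpose P = P \<and> P \<noteq> 1\<^sub>m n \<and> P * P = 1\<^sub>m n"

definition gen_antireflexive :: "nat \<Rightarrow> quat mat \<Rightarrow> quat mat \<Rightarrow> quat mat set" where
  "gen_antireflexive n P Q = {A \<in> carrier_mat n n. A = - (P * A * Q)}"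

definition reflexive_inverse :: "quat mat \<Rightarrow> quat mat \<Rightarrow> bool" where
  "reflexive_inverse X Xp \<longleftrightarrow> Xp \<in> carrier_mat (dim_col X) (dim_row X) \<and>
     X * Xp * X = X \<and> Xp * X * Xp = Xp"

text \<open>The matrix \<open>R\<^sub>X = I - X X\<^sup>+\<close>, with the chosen inverse \<open>X\<^sup>+\<close> as an explicit argument.\<close>

definition R_mat :: "quat mat \<Rightarrow> quat mat \<Rightarrow> quat mat" where
  "R_mat X Xp = 1\<^sub>m (dim_row X) - X * Xp"

text \<open>Diagonal matrix \<open>diag (z 0, \<dots>, z (k - 1))\<close> of complex numbers, viewed over the quaternions.\<close>

definition complex_diag :: "nat \<Rightarrow> (nat \<Rightarrow> complex) \<Rightarrow> quat mat" where
  "complex_diag k z = mat_diag k (\<lambda>i. quat_of_complex (z i))"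

definition signature_mat :: "nat \<Rightarrow> nat \<Rightarrow> quat mat" where
  "signature_mat r s = four_block_mat (1\<^sub>m r) (0\<^sub>m r s) (0\<^sub>m s r) (- 1\<^sub>m s)"

definition phi2 :: "nat \<Rightarrow> quat mat \<Rightarrow> quat mat \<Rightarrow> quat mat \<Rightarrow> quat mat \<Rightarrow> quat mat set" where
  "phi2 n P Q Z L = {A \<in> gen_antireflexive n P Q. A * Z = Z * L}"

end

theory Submission
  imports Defs
begin

text \<open>In the coordinates given by \<open>U\<close> and \<open>V\<close>, antireflexivity of \<open>A\<close> says that the two diagonal
  blocks vanish, and \<open>A * Z = Z * \<Lambda>\<close> decouples into \<open>B * X1 = Y1 * \<Phi>\<close> and \<open>C * X2 = Y2 * \<Psi>\<close> for the
  off-diagonal blocks \<open>B\<close> and \<open>C\<close>. The Frobenius norm is unitarily invariant, so the two blocks are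
  approximated independently. If \<open>X * G\<close> is the orthogonal projection onto the column space of \<open>X\<close>,
  the constraint fixes \<open>B * X * G\<close> and leaves \<open>B * (1 - X * G)\<close> free; by Pythagoras the best choice
  of the latter is \<open>E * (1 - X * G)\<close>. A \<open>G\<close> with \<open>X * G\<close> Hermitian always exists, hence so does a unique
  minimiser, whether or not the prescribed reflexive inverses have this property.\<close>

section \<open>Block matrices\<close>

text \<open>The side conditions of this and the next four laws are equations between dimensions
  instead of carrier memberships: the simplifier discharges them without guessing sizes, so the laws
  work as rewrite rules.\<close>

lemma mult_mat_assoc_dim:
  fixes A :: "'a::semiring_0 mat"
  assumes "dim_col A = dim_row B" "dim_col B = dim_row C"
  shows "A * B * C = A * (B * C)"
  by (rule assoc_mult_mat[of A "dim_row A" "dim_col A" B "dim_col B" C "dim_col C"])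
    (use assms in auto)

lemma mult_add_distrib_mat_dim:
  fixes A :: "'a::semiring_0 mat"
  assumes "dim_col A = dim_row B" "dim_row B = dim_row C" "dim_col B = dim_col C"
  shows "A * (B + C) = A * B + A * C"
  by (rule mult_add_distrib_mat[of A "dim_row A" "dim_col A" B "dim_col B" C])
    (use assms in auto)

lemma add_mult_distrib_mat_dim:
  fixes A :: "'a::semiring_0 mat"
  assumes "dim_row A = dim_row B" "dim_col A = dim_col B" "dim_row C = dim_col A"
  shows "(A + B) * C = A * C + B * C"
  by (rule add_mult_distrib_mat[of A "dim_row A" "dim_col A" B C "dim_col C"])
    (use assms in auto)

lemma mult_minus_distrib_mat_dim:
  fixes A :: "'a::ring mat"
  assumes "dim_col A = dim_row B" "dim_row B = dim_row C" "dim_col B = dim_col C"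
  shows "A * (B - C) = A * B - A * C"
  by (rule mult_minus_distrib_mat[of A "dim_row A" "dim_col A" B "dim_col B" C])
    (use assms in auto)

lemma minus_mult_distrib_mat_dim:
  fixes A :: "'a::ring mat"
  assumes "dim_row A = dim_row B" "dim_col A = dim_col B" "dim_row C = dim_col A"
  shows "(A - B) * C = A * C - B * C"
  by (rule minus_mult_distrib_mat[of A "dim_row A" "dim_col A" B C "dim_col C"])
    (use assms in auto)

text \<open>Brackets move only on request from here on; a default rule pushing them to the right
  would fight the reversed law \<open>flip: mult_mat_assoc_dim\<close> used below.\<close>

declare assoc_mult_mat [simp del]

lemmas mat_ring_simps = mult_mat_assoc_dim mult_add_distrib_mat_dim add_mult_distrib_mat_dim
  mult_minus_distrib_mat_dim minus_mult_distrib_mat_dim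

text \<open>Both matrices are cut after row \<open>nr1\<close> and column \<open>nc1\<close>, so
  corresponding blocks occupy the same index ranges and can be read off at shifted indices.\<close>

lemma four_block_mat_inject:
  assumes "four_block_mat A B C D = four_block_mat A' B' C' D'"
    and A: "A \<in> carrier_mat nr1 nc1" and B: "B \<in> carrier_mat nr1 nc2"
    and C: "C \<in> carrier_mat nr2 nc1" and D: "D \<in> carrier_mat nr2 nc2"
    and A': "A' \<in> carrier_mat nr1 nc1" and B': "B' \<in> carrier_mat nr1 nc2"
    and C': "C' \<in> carrier_mat nr2 nc1" and D': "D' \<in> carrier_mat nr2 nc2"
  shows "A = A'" "B = B'" "C = C'" "D = D'"
proof -
  have eq: "four_block_mat A B C D $$ (i, j) = four_block_mat A' B' C' D' $$ (i, j)" for i j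
    using assms(1) by simp
  show "A = A'"
  proof (rule eq_matI)
    fix i j assume "i < dim_row A'" "j < dim_col A'"
    then show "A $$ (i, j) = A' $$ (i, j)" using eq[of i j] A A' D D' by auto
  qed (use A A' in auto)
  show "B = B'"
  proof (rule eq_matI)
    fix i j assume "i < dim_row B'" "j < dim_col B'"
    then show "B $$ (i, j) = B' $$ (i, j)" using eq[of i "j + nc1"] A B A' B' D D' by auto
  qed (use B B' in auto)
  show "C = C'"
  proof (rule eq_matI)
    fix i j assume "i < dim_row C'" "j < dim_col C'"
    then show "C $$ (i, j) = C' $$ (i, j)" using eq[of "i + nr1" j] A C A' C' D D' by auto
  qed (use C C' in auto)
  show "D = D'"
  proof (rule eq_matI)
    fix i j assume "i < dim_row D'" "j < dim_col D'"
    then show "D $$ (i, j) = D' $$ (i, j)" using eq[of "i + nr1" "j + nc1"] A A' D D' by auto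
  qed (use D D' in auto)
qed

lemma minus_four_block_mat:
  fixes A :: "'a::group_add mat"
  assumes "A \<in> carrier_mat nr1 nc1" "B \<in> carrier_mat nr1 nc2"
    "C \<in> carrier_mat nr2 nc1" "D \<in> carrier_mat nr2 nc2"
    "A' \<in> carrier_mat nr1 nc1" "B' \<in> carrier_mat nr1 nc2"
    "C' \<in> carrier_mat nr2 nc1" "D' \<in> carrier_mat nr2 nc2"
  shows "four_block_mat A B C D - four_block_mat A' B' C' D'
    = four_block_mat (A - A') (B - B') (C - C') (D - D')"
  by (rule eq_matI) (use assms in auto)

lemma uminus_four_block_mat:
  fixes A :: "'a::group_add mat"
  assumes "A \<in> carrier_mat nr1 nc1" "B \<in> carrier_mat nr1 nc2"
    "C \<in> carrier_mat nr2 nc1" "D \<in> carrier_mat nr2 nc2"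
  shows "- four_block_mat A B C D = four_block_mat (- A) (- B) (- C) (- D)"
  by (rule eq_matI) (use assms in auto)

lemma uminus_zero_mat [simp]: "- (0\<^sub>m nr nc :: 'a::group_add mat) = 0\<^sub>m nr nc"
  by (rule eq_matI) auto

text \<open>Appended columns are a block matrix whose lower blocks have height 0, so the general
  block product applies.\<close>

lemma append_cols_mult_four_block:
  fixes U1 :: "'a::semiring_0 mat"
  assumes "U1 \<in> carrier_mat n a" "U2 \<in> carrier_mat n b"
    "A \<in> carrier_mat a c" "B \<in> carrier_mat a d" "C \<in> carrier_mat b c" "D \<in> carrier_mat b d"
  shows "append_cols U1 U2 * four_block_mat A B C D
    = append_cols (U1 * A + U2 * C) (U1 * B + U2 * D)"
  unfolding append_cols_def
  by (subst mult_four_block_mat[of _ n a _ b _ 0 _ _ c _ d]) (use assms in auto)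

section \<open>Conjugate transpose and Frobenius norm\<close>

lemma qcnj_simps [simp]:
  "qcnj 0 = 0" "qcnj (a + b) = qcnj a + qcnj b" "qcnj (a - b) = qcnj a - qcnj b"
  "qcnj (- a) = - qcnj a" "qcnj (a * b) = qcnj b * qcnj a" "qcnj (qcnj a) = a" "qcnj 1 = 1"
  by (simp_all add: qcnj_def quat_defs algebra_simps)

lemma qcnj_sum: "qcnj (sum f S) = (\<Sum>x\<in>S. qcnj (f x))"
  by (induction S rule: infinite_finite_induct) simp_all

lemma conj_transpose_dim [simp]:
  "dim_row (conj_transpose A) = dim_col A" "dim_col (conj_transpose A) = dim_row A"
  by (simp_all add: conj_transpose_def)

lemma conj_transpose_carrier [simp]:
  "conj_transpose A \<in> carrier_mat nr nc \<longleftrightarrow> A \<in> carrier_mat nc nr"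
  by (auto simp: conj_transpose_def)

lemma conj_transpose_index [simp]:
  "i < dim_col A \<Longrightarrow> j < dim_row A \<Longrightarrow> conj_transpose A $$ (i, j) = qcnj (A $$ (j, i))"
  by (simp add: conj_transpose_def)

lemma conj_transpose_conj_transpose [simp]: "conj_transpose (conj_transpose A) = A"
  by (rule eq_matI) auto

lemma conj_transpose_one [simp]: "conj_transpose (1\<^sub>m n) = 1\<^sub>m n"
  by (rule eq_matI) auto

text \<open>Over a noncommutative ring plain transposition does not reverse products; conjugation
  reverses the scalar products and so restores the right order of factors.\<close>

lemma conj_transpose_mult:
  assumes "dim_col A = dim_row B"
  shows "conj_transpose (A * B) = conj_transpose B * conj_transpose A"
  by (rule eq_matI) (use assms in \<open>auto simp: scalar_prod_def qcnj_sum\<close>)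

lemma conj_transpose_add:
  assumes "dim_row A = dim_row B" "dim_col A = dim_col B"
  shows "conj_transpose (A + B) = conj_transpose A + conj_transpose B"
  by (rule eq_matI) (use assms in auto)

lemma conj_transpose_minus:
  assumes "dim_row A = dim_row B" "dim_col A = dim_col B"
  shows "conj_transpose (A - B) = conj_transpose A - conj_transpose B"
  by (rule eq_matI) (use assms in auto)

text \<open>Turns the stacked adjoint blocks of the final statement into the adjoint of one unitary
  matrix.\<close>

lemma append_rows_conj_transpose:
  assumes "dim_row A = dim_row B"
  shows "append_rows (conj_transpose A) (conj_transpose B) = conj_transpose (append_cols A B)"
  by (rule eq_matI) (use assms in \<open>auto simp: append_rows_def append_cols_def\<close>)

lemma frob_norm_sq:
  "(frob_norm A)\<^sup>2 = (\<Sum>j<dim_col A. \<Sum>i<dim_row A.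
     (qRe (A $$ (i, j)))\<^sup>2 + (qI (A $$ (i, j)))\<^sup>2 + (qJ (A $$ (i, j)))\<^sup>2 + (qK (A $$ (i, j)))\<^sup>2)"
  unfolding frob_norm_def frob_inner_self
  by (simp add: of_real_quat sum_nonneg)

lemma frob_norm_nonneg [simp]: "0 \<le> frob_norm A"
  unfolding frob_norm_def frob_inner_self
  by (simp add: of_real_quat sum_nonneg)

lemma frob_norm_sq_trace: "(frob_norm A)\<^sup>2 = qRe (trace_mat (conj_transpose A * A))"
  unfolding frob_norm_sq using frob_inner_self[of A]
  by (simp add: frob_inner_def of_real_quat)

lemma frob_norm_conj_transpose [simp]: "frob_norm (conj_transpose A) = frob_norm A"
proof -
  have "(frob_norm (conj_transpose A))\<^sup>2 = (frob_norm A)\<^sup>2"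
    unfolding frob_norm_sq by (subst sum.swap) (simp add: qcnj_def)
  then show ?thesis by simp
qed

text \<open>The quaternionic trace is not cyclic, so this form comes from invariance of the norm
  under adjoints. It is the one suited to multiplication by projections on the right.\<close>

lemma frob_norm_sq_trace': "(frob_norm A)\<^sup>2 = qRe (trace_mat (A * conj_transpose A))"
  using frob_norm_sq_trace[of "conj_transpose A"] by simp

lemma frob_norm_eq_0:
  assumes "frob_norm A = 0" "A \<in> carrier_mat nr nc"
  shows "A = 0\<^sub>m nr nc"
proof -
  have "(\<Sum>j<nc. \<Sum>i<nr. (qRe (A $$ (i, j)))\<^sup>2 + (qI (A $$ (i, j)))\<^sup>2
      + (qJ (A $$ (i, j)))\<^sup>2 + (qK (A $$ (i, j)))\<^sup>2) = 0"
    using frob_norm_sq[of A] assms by simp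
  then have z: "(qRe (A $$ (i, j)))\<^sup>2 + (qI (A $$ (i, j)))\<^sup>2
      + (qJ (A $$ (i, j)))\<^sup>2 + (qK (A $$ (i, j)))\<^sup>2 = 0" if "i < nr" "j < nc" for i j
    using that by (simp add: sum_nonneg_eq_0_iff sum_nonneg)
  have "A $$ (i, j) = 0" if "i < nr" "j < nc" for i j
    using z[OF that] quat_norm2_pos[of "A $$ (i, j)"] by force
  then show ?thesis using assms by (intro eq_matI) auto
qed

lemma frob_norm_four_block:
  assumes "A \<in> carrier_mat nr1 nc1" "B \<in> carrier_mat nr1 nc2"
    "C \<in> carrier_mat nr2 nc1" "D \<in> carrier_mat nr2 nc2"
  shows "(frob_norm (four_block_mat A B C D))\<^sup>2
    = (frob_norm A)\<^sup>2 + (frob_norm B)\<^sup>2 + (frob_norm C)\<^sup>2 + (frob_norm D)\<^sup>2"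
proof -
  have split: "(\<Sum>i<a + b. f i) = (\<Sum>i<a. f i) + (\<Sum>i<b. f (a + i))" for a b and f :: "nat \<Rightarrow> real"
    by (induction b) (simp_all add: add.assoc)
  show ?thesis
    unfolding frob_norm_sq using assms by (simp add: split sum.distrib)
qed

lemma trace_mat_add:
  assumes "A \<in> carrier_mat n n" "B \<in> carrier_mat n n"
  shows "trace_mat (A + B) = trace_mat A + trace_mat B"
  using assms by (simp add: trace_mat_def sum.distrib)

text \<open>The norm depends only on the Gram matrix \<open>conj_transpose M * M\<close>, which an
  isometry on the left leaves unchanged.\<close>

lemma frob_norm_isometry_left:
  assumes "conj_transpose U * U = 1\<^sub>m n" "dim_col U = n" "dim_row M = n"
  shows "frob_norm (U * M) = frob_norm M"
proof -
  have "conj_transpose (U * M) * (U * M) = conj_transpose M * (conj_transpose U * U * M)"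
    using assms(2,3) by (simp add: conj_transpose_mult mult_mat_assoc_dim)
  also have "\<dots> = conj_transpose M * M" using assms by simp
  finally have "(frob_norm (U * M))\<^sup>2 = (frob_norm M)\<^sup>2" unfolding frob_norm_sq_trace by simp
  then show ?thesis by simp
qed

text \<open>Taking adjoints carries the right factor to the left.\<close>

lemma frob_norm_isometry_right:
  assumes "conj_transpose V * V = 1\<^sub>m n" "dim_col V = n" "dim_col M = n"
  shows "frob_norm (M * conj_transpose V) = frob_norm M"
proof -
  have "M * conj_transpose V = conj_transpose (V * conj_transpose M)"
    using assms by (simp add: conj_transpose_mult)
  then show ?thesis using assms by (simp add: frob_norm_isometry_left)
qed

text \<open>For a Hermitian idempotent \<open>P\<close>, the product of \<open>D * P\<close> with
  its adjoint collapses to \<open>D * P * conj_transpose D\<close>. The same holds for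
  \<open>1 - P\<close>, and the two add up to \<open>D * conj_transpose D\<close> without cross
  terms.\<close>

lemma frob_norm_pythagoras:
  assumes D: "D \<in> carrier_mat k n" and P: "P \<in> carrier_mat n n"
    and herm: "conj_transpose P = P" and idem: "P * P = P"
  shows "(frob_norm D)\<^sup>2 = (frob_norm (D * P))\<^sup>2 + (frob_norm (D * (1\<^sub>m n - P)))\<^sup>2"
proof -
  define R where "R = 1\<^sub>m n - P"
  have R: "R \<in> carrier_mat n n" unfolding R_def using P by auto
  have hR: "conj_transpose R = R" unfolding R_def using P herm by (simp add: conj_transpose_minus)
  have iR: "R * R = R" unfolding R_def using P idem
    by (simp add: mat_ring_simps) (intro eq_matI; simp)
  have "D * P * conj_transpose (D * P) = D * (P * P) * conj_transpose D"
    using D P herm by (simp add: conj_transpose_mult mult_mat_assoc_dim)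
  moreover have "D * R * conj_transpose (D * R) = D * (R * R) * conj_transpose D"
    using D R hR by (simp add: conj_transpose_mult mult_mat_assoc_dim)
  moreover have "D * P * conj_transpose D + D * R * conj_transpose D = D * (P + R) * conj_transpose D"
    using D P R by (simp add: mat_ring_simps)
  moreover have "P + R = 1\<^sub>m n" unfolding R_def using P by (intro eq_matI) auto
  ultimately have "D * conj_transpose D
      = D * P * conj_transpose (D * P) + D * R * conj_transpose (D * R)"
    using D idem iR by simp
  moreover have c: "D * P * conj_transpose (D * P) \<in> carrier_mat k k"
    "D * R * conj_transpose (D * R) \<in> carrier_mat k k"
    using D by (auto intro!: carrier_matI)
  ultimately have "(frob_norm D)\<^sup>2 = (frob_norm (D * P))\<^sup>2 + (frob_norm (D * R))\<^sup>2"
    unfolding frob_norm_sq_trace'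
    using trace_mat_add[OF c] by (simp add: plus_quat_def)
  then show ?thesis unfolding R_def .
qed

section \<open>Orthogonal projections onto column spaces\<close>

text \<open>The single entry is a real quaternion, hence a central scalar; this is what allows a
  residual column to be normalised.\<close>

lemma conj_transpose_mult_self_column:
  assumes "w \<in> carrier_mat n 1"
  shows "conj_transpose w * w = mat 1 1 (\<lambda>_. of_real ((frob_norm w)\<^sup>2))"
proof -
  have "(conj_transpose w * w) $$ (0, 0) = frob_inner w w"
    using assms by (simp add: frob_inner_def trace_mat_def)
  also have "\<dots> = of_real ((frob_norm w)\<^sup>2)"
    unfolding frob_norm_sq frob_inner_self ..
  finally show ?thesis using assms by (intro eq_matI) (auto simp del: index_mult_mat(1))
qed

text \<open>Gram--Schmidt: the orthogonal projection \<open>X * G\<close> onto the span of the first \<open>k\<close> columns of \<open>X\<close>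
  is enlarged by the rank-one projection onto the normalised residual \<open>q\<close> of the next column.\<close>

lemma exists_hermitian_inner_inverse:
  assumes X: "X \<in> carrier_mat n m"
  shows "\<exists>G \<in> carrier_mat m n. X * G * X = X \<and> conj_transpose (X * G) = X * G"
proof -
  \<comment> \<open>Unit columns make \<open>X * e j\<close> the \<open>j\<close>-th column of
    \<open>X\<close> as a matrix, so the matrix ring laws apply to it. For \<open>j \<ge> m\<close>
    the column is zero, which lets the induction on \<open>k\<close> run without a bound.\<close>
  define e :: "nat \<Rightarrow> quat mat" where "e j = mat m 1 (\<lambda>(i, _). if i = j then 1 else 0)" for j
  have e: "e j \<in> carrier_mat m 1" for j by (simp add: e_def)
  have e_index: "(M * e j) $$ (i, 0) = M $$ (i, j)" if "M \<in> carrier_mat n m" "i < n" "j < m" for M i j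
  proof -
    have "(M * e j) $$ (i, 0) = (\<Sum>k = 0..<m. M $$ (i, k) * (if k = j then 1 else 0))"
      using that by (simp add: e_def scalar_prod_def)
    also have "\<dots> = (\<Sum>k = 0..<m. if k = j then M $$ (i, k) else 0)"
      by (rule sum.cong) auto
    also have "\<dots> = M $$ (i, j)" using that by simp
    finally show ?thesis .
  qed
  \<comment> \<open>Idempotence is carried along because fixing only the first \<open>k\<close>
    columns does not imply it, and the next step relies on it.\<close>
  have "\<exists>G \<in> carrier_mat m n. conj_transpose (X * G) = X * G \<and> X * G * (X * G) = X * G \<and>
      (\<forall>j<k. X * G * (X * e j) = X * e j)" for k
  proof (induction k)
    case 0
    have "conj_transpose (0\<^sub>m n n) = 0\<^sub>m n n" by (rule eq_matI) auto
    then show ?case using X by (intro bexI[of _ "0\<^sub>m m n"]) auto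
  next
    case (Suc k)
    then obtain G where G: "G \<in> carrier_mat m n" and herm: "conj_transpose (X * G) = X * G"
      and idem: "X * G * (X * G) = X * G" and fix_cols: "\<And>j. j < k \<Longrightarrow> X * G * (X * e j) = X * e j"
      by blast
    define P where "P = X * G"
    define x where "x = X * e k"
    define w where "w = x - P * x"
    have P: "P \<in> carrier_mat n n" and x: "x \<in> carrier_mat n 1"
      using X G e[of k] by (auto simp: P_def x_def)
    have w: "w \<in> carrier_mat n 1" unfolding w_def using P x by auto
    have x_split: "x = P * x + w" unfolding w_def using P x by (intro eq_matI) auto
    have hP: "conj_transpose P = P" using herm unfolding P_def .
    have PP: "P * P = P" using idem unfolding P_def .
    show ?case
    proof (cases "frob_norm w = 0")
      case True
      \<comment> \<open>The new column already lies in the range of \<open>P\<close>, so the same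
        \<open>G\<close> serves.\<close>
      then have "w = 0\<^sub>m n 1" using w by (rule frob_norm_eq_0)
      then have "P * x = x" using x_split P x by auto
      then show ?thesis
        using G herm idem fix_cols by (intro bexI[of _ G]) (auto simp: P_def x_def less_Suc_eq)
    next
      case False
      define s where "s = frob_norm w"
      \<comment> \<open>Scalars are kept as 1 by 1 matrices so that the ring laws cover them:
        \<open>d\<close> normalises \<open>w\<close> from the right and \<open>c\<close> undoes
        this.\<close>
      define d :: "quat mat" where "d = mat 1 1 (\<lambda>_. of_real (1 / s))"
      define c :: "quat mat" where "c = mat 1 1 (\<lambda>_. of_real s)"
      \<comment> \<open>Chosen as a preimage of \<open>q\<close>: since
        \<open>w = X * (e k - G * x)\<close>, one gets \<open>X * u = q\<close>. Adding
        \<open>u * conj_transpose q\<close> to \<open>G\<close> then adds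
        \<open>q * conj_transpose q\<close> to \<open>X * G\<close>.\<close>
      define u where "u = (e k - G * x) * d"
      define q where "q = w * d"
      have s: "s \<noteq> 0" using False by (simp add: s_def)
      have d: "d \<in> carrier_mat 1 1" and c: "c \<in> carrier_mat 1 1" by (auto simp: d_def c_def)
      have u: "u \<in> carrier_mat m 1" using G x e[of k] d by (auto simp: u_def)
      have q: "q \<in> carrier_mat n 1" using w d by (auto simp: q_def)
      have Xu: "X * u = q"
        unfolding u_def q_def w_def P_def x_def using X G e[of k] d by (simp add: mat_ring_simps)
      have inv_s: "of_real (1 / s) * of_real s = (1::quat)"
        "of_real (1 / s) * (of_real s * of_real s) * of_real (1 / s) = (1::quat)"
        unfolding of_real_mult[symmetric] using s by simp_all
      have dc: "d * c = 1\<^sub>m 1"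
        using inv_s by (intro eq_matI) (auto simp: d_def c_def scalar_prod_def simp del: of_real_divide)
      have qc: "q * c = w" unfolding q_def using w d c dc by (simp add: mult_mat_assoc_dim)
      have hd: "conj_transpose d = d"
        by (rule eq_matI) (auto simp: d_def of_real_quat qcnj_def)
      have "conj_transpose q * q = d * (conj_transpose w * w) * d"
        unfolding q_def using w d hd by (simp add: conj_transpose_mult mult_mat_assoc_dim)
      also have "\<dots> = 1\<^sub>m 1"
        unfolding conj_transpose_mult_self_column[OF w] s_def[symmetric]
        by (intro eq_matI) (auto simp: d_def scalar_prod_def power2_eq_square inv_s simp del: of_real_divide)
      finally have qq: "conj_transpose q * q = 1\<^sub>m 1" .
      \<comment> \<open>The projection annihilates the residual, hence also \<open>q\<close>; taking
        adjoints gives the mirrored identity. Both cross terms in \<open>P' * P'\<close> vanish for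
        this reason.\<close>
      have "P * w = P * x - P * P * x"
        unfolding w_def using P x by (simp add: mat_ring_simps)
      then have "P * w = 0\<^sub>m n 1" using PP P x by simp
      then have Pq: "P * q = 0\<^sub>m n 1"
        unfolding q_def using P w d by (simp flip: mult_mat_assoc_dim)
      have "conj_transpose q * P = conj_transpose (P * q)"
        using P q hP by (simp add: conj_transpose_mult)
      also have "\<dots> = 0\<^sub>m 1 n" unfolding Pq by (rule eq_matI) auto
      finally have qP: "conj_transpose q * P = 0\<^sub>m 1 n" .
      define G' where "G' = G + u * conj_transpose q"
      have G': "G' \<in> carrier_mat m n" using G u q by (simp add: G'_def)
      define P' where "P' = P + q * conj_transpose q"
      have XG': "X * G' = P'"
        unfolding G'_def P'_def P_def using X G u q Xu
        by (simp add: mult_add_distrib_mat_dim flip: mult_mat_assoc_dim)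
      have P'_mult: "P' * y = P * y + q * (conj_transpose q * y)" if "y \<in> carrier_mat n t" for y t
        unfolding P'_def using P q that by (simp add: mat_ring_simps)
      have "conj_transpose P' = P'"
        unfolding P'_def using P q hP
        by (simp add: conj_transpose_add conj_transpose_mult)
      moreover have "P' * P' = P'"
      proof -
        have "conj_transpose q * P' = conj_transpose q * P + conj_transpose q * q * conj_transpose q"
          unfolding P'_def using P q by (simp add: mat_ring_simps)
        also have "\<dots> = conj_transpose q" using qP qq q by simp
        finally have 1: "conj_transpose q * P' = conj_transpose q" .
        have "P * P' = P * P + P * q * conj_transpose q"
          unfolding P'_def using P q by (simp add: mat_ring_simps)
        also have "\<dots> = P" using PP Pq P q by simp
        finally have 2: "P * P' = P" .
        have "P' \<in> carrier_mat n n" using P q by (simp add: P'_def)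
        from P'_mult[OF this] show ?thesis unfolding 1 2 by (simp add: P'_def)
      qed
      moreover have "P' * (X * e j) = X * e j" if "j < Suc k" for j
      proof (cases "j = k")
        case True
        \<comment> \<open>Expanding \<open>x = P * x + q * c\<close> shows that the coefficient of
          \<open>x\<close> along \<open>q\<close> is \<open>c\<close>; hence
          \<open>P' * x = P * x + q * c = x\<close>.\<close>
        have "conj_transpose q * x = conj_transpose q * P * x + conj_transpose q * q * c"
          by (subst x_split, subst qc[symmetric]) (use P x q c in \<open>simp add: mat_ring_simps\<close>)
        also have "\<dots> = c" using qP qq x c by simp
        finally show ?thesis
          using True P'_mult[OF x] qc x_split unfolding x_def by simp
      next
        case False
        then have j: "P * (X * e j) = X * e j" using that fix_cols unfolding P_def by simp
        have y: "X * e j \<in> carrier_mat n 1" using X e[of j] by simp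
        \<comment> \<open>An earlier column lies in the range of \<open>P\<close>, so it is
          orthogonal to \<open>q\<close> and the rank-one update leaves it alone.\<close>
        have "conj_transpose q * (X * e j) = conj_transpose q * P * (X * e j)"
          using P q X e[of j] j by (simp add: mult_mat_assoc_dim)
        also have "\<dots> = 0\<^sub>m 1 1" using qP X e[of j] by simp
        finally show ?thesis using P'_mult[OF y] j q y by simp
      qed
      ultimately show ?thesis using G' XG' by blast
    qed
  qed
  then obtain G where G: "G \<in> carrier_mat m n" and herm: "conj_transpose (X * G) = X * G"
    and fix_cols: "\<And>j. j < m \<Longrightarrow> X * G * (X * e j) = X * e j"
    by blast
  \<comment> \<open>The case \<open>k = m\<close> covers every column, and two matrices that agree
    on all unit columns are equal.\<close>
  have "X * G * X = X"
  proof (rule eq_matI)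
    fix i j assume ij: "i < dim_row X" "j < dim_col X"
    have "X * G * X * e j = X * e j"
      using fix_cols[of j] ij X G e[of j] by (simp add: mult_mat_assoc_dim)
    moreover have "X * G * X \<in> carrier_mat n m" using X G by (intro carrier_matI) auto
    ultimately show "(X * G * X) $$ (i, j) = X $$ (i, j)"
      using e_index[of "X * G * X" i j] e_index[of X i j] ij X
      by (simp del: index_mult_mat(1))
  qed (use X G in auto)
  then show ?thesis using G herm by blast
qed

section \<open>Generalized antireflexive matrices\<close>

text \<open>Each entry has four real coordinates, and a real number equal to its negative is
  zero.\<close>

lemma quat_mat_eq_minus_self:
  fixes A :: "quat mat"
  assumes "A = - A" "A \<in> carrier_mat nr nc"
  shows "A = 0\<^sub>m nr nc"
proof (rule eq_matI)
  fix i j assume ij: "i < dim_row (0\<^sub>m nr nc :: quat mat)" "j < dim_col (0\<^sub>m nr nc :: quat mat)"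
  have "A $$ (i, j) = (- A) $$ (i, j)" using assms(1) by (rule arg_cong)
  also have "\<dots> = - (A $$ (i, j))" using ij assms(2) by simp
  finally show "A $$ (i, j) = 0\<^sub>m nr nc $$ (i, j)"
    using ij by (simp add: quat_eq_iff quat_defs)
qed (use assms(2) in auto)

lemma signature_mat_carrier: "r \<le> n \<Longrightarrow> signature_mat r (n - r) \<in> carrier_mat n n"
  unfolding signature_mat_def by (intro carrier_matI) simp_all

text \<open>The left factor negates the lower block row and the right factor the right block column;
  the lower right block is negated twice.\<close>

lemma signature_mat_conjugate:
  assumes "A \<in> carrier_mat r1 r2" "B \<in> carrier_mat r1 s2" "C \<in> carrier_mat s1 r2" "D \<in> carrier_mat s1 s2"
  shows "signature_mat r1 s1 * four_block_mat A B C D * signature_mat r2 s2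
    = four_block_mat A (- B) (- C) D"
proof -
  have "signature_mat r1 s1 * four_block_mat A B C D = four_block_mat A B (- C) (- D)"
    unfolding signature_mat_def
    by (subst mult_four_block_mat[of _ r1 r1 _ s1 _ s1 _ _ r2 _ s2])
      (use assms in \<open>auto intro!: cong_four_block_mat eq_matI\<close>)
  moreover have "four_block_mat A B (- C) (- D) * signature_mat r2 s2
      = four_block_mat A (- B) (- C) D"
    unfolding signature_mat_def
    by (subst mult_four_block_mat[of _ r1 r2 _ s2 _ s1 _ _ r2 _ s2])
      (use assms in \<open>auto intro!: cong_four_block_mat eq_matI\<close>)
  ultimately show ?thesis by simp
qed

text \<open>The right-nested form is the one \<open>mult_mat_assoc_dim\<close> produces, so unitary
  factors cancel inside long products.\<close>

lemma unitary_cancel: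
  assumes "unitary_quat_mat n U" "dim_row M = n"
  shows "conj_transpose U * (U * M) = M" "U * (conj_transpose U * M) = M"
proof -
  have U: "U \<in> carrier_mat n n" using assms unfolding unitary_quat_mat_def by simp
  have "conj_transpose U * (U * M) = conj_transpose U * U * M"
    and "U * (conj_transpose U * M) = U * conj_transpose U * M"
    using U assms(2) by (simp_all add: mult_mat_assoc_dim)
  then show "conj_transpose U * (U * M) = M" "U * (conj_transpose U * M) = M"
    using assms unfolding unitary_quat_mat_def by simp_all
qed

text \<open>For \<open>M = conj_transpose U * A * V\<close> the condition becomes
  \<open>M = - (S1 * M * S2)\<close>. The sign pattern makes the diagonal blocks equal to their own
  negatives and puts no restriction on the other two.\<close>

lemma gen_antireflexive_block_iff:
  assumes U: "unitary_quat_mat n U" and V: "unitary_quat_mat n V" and r: "r1 \<le> n" "r2 \<le> n"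
    and P: "P = U * signature_mat r1 (n - r1) * conj_transpose U"
    and Q: "Q = V * signature_mat r2 (n - r2) * conj_transpose V"
  shows "A \<in> gen_antireflexive n P Q \<longleftrightarrow>
    (\<exists>B \<in> carrier_mat r1 (n - r2). \<exists>C \<in> carrier_mat (n - r1) r2.
      A = U * four_block_mat (0\<^sub>m r1 r2) B C (0\<^sub>m (n - r1) (n - r2)) * conj_transpose V)"
    (is "_ \<longleftrightarrow> ?R")
proof -
  define S1 where "S1 = signature_mat r1 (n - r1)"
  define S2 where "S2 = signature_mat r2 (n - r2)"
  have S: "S1 \<in> carrier_mat n n" "S2 \<in> carrier_mat n n"
    unfolding S1_def S2_def using r by (simp_all add: signature_mat_carrier)
  have Uc: "U \<in> carrier_mat n n" and Vc: "V \<in> carrier_mat n n"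
    using U V unfolding unitary_quat_mat_def by simp_all
  have PAQ: "P * (U * M * conj_transpose V) * Q = U * (S1 * M * S2) * conj_transpose V"
    if "M \<in> carrier_mat n n" for M
    unfolding P Q S1_def[symmetric] S2_def[symmetric]
    using that S Uc Vc U V by (simp add: mult_mat_assoc_dim unitary_cancel)
  show ?thesis
  proof
    assume A: "A \<in> gen_antireflexive n P Q"
    then have Ac: "A \<in> carrier_mat n n" and eq: "A = - (P * A * Q)"
      by (auto simp: gen_antireflexive_def)
    define M where "M = conj_transpose U * A * V"
    have M: "M \<in> carrier_mat n n" using Uc Vc Ac by (auto simp: M_def)
    have A_M: "A = U * M * conj_transpose V"
    proof -
      have "V * conj_transpose V = 1\<^sub>m n" using V by (simp add: unitary_quat_mat_def)
      then show ?thesis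
        unfolding M_def using Uc Vc Ac U by (simp add: mult_mat_assoc_dim unitary_cancel)
    qed
    have "P * A * Q = U * (S1 * M * S2) * conj_transpose V" by (subst A_M) (rule PAQ[OF M])
    with eq have "A = - (U * (S1 * M * S2) * conj_transpose V)" by (rule subst[rotated])
    \<comment> \<open>Multiplying by \<open>conj_transpose U\<close> and \<open>V\<close> strips the
      outer factors and leaves an equation in \<open>M\<close> alone.\<close>
    from arg_cong[OF this, of "\<lambda>A. conj_transpose U * A * V"]
    have "M = conj_transpose U * (- (U * (S1 * M * S2) * conj_transpose V)) * V"
      unfolding M_def[symmetric] .
    also have "\<dots> = - (conj_transpose U * (U * (S1 * M * S2) * conj_transpose V) * V)"
      using Uc Vc S M by simp
    also have "conj_transpose U * (U * (S1 * M * S2) * conj_transpose V) * V = S1 * M * S2"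
    proof -
      have "conj_transpose V * V = 1\<^sub>m n" using V by (simp add: unitary_quat_mat_def)
      then show ?thesis
        using Uc Vc S M U by (simp add: mult_mat_assoc_dim unitary_cancel)
    qed
    finally have M_eq: "M = - (S1 * M * S2)" .
    obtain M11 B C M22 where split: "split_block M r1 r2 = (M11, B, C, M22)"
      by (cases "split_block M r1 r2")
    note blocks = split_block[OF split, of "n - r1" "n - r2"]
    have bc: "M11 \<in> carrier_mat r1 r2" "B \<in> carrier_mat r1 (n - r2)"
      "C \<in> carrier_mat (n - r1) r2" "M22 \<in> carrier_mat (n - r1) (n - r2)"
      and M_blocks: "M = four_block_mat M11 B C M22"
      using blocks M r by auto
    have "four_block_mat M11 B C M22 = - four_block_mat M11 (- B) (- C) M22"
      using M_eq unfolding M_blocks S1_def S2_def signature_mat_conjugate[OF bc] .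
    also have "\<dots> = four_block_mat (- M11) B C (- M22)"
      using bc by (subst uminus_four_block_mat) auto
    finally have eq: "four_block_mat M11 B C M22 = four_block_mat (- M11) B C (- M22)" .
    have "M11 = - M11" by (rule four_block_mat_inject(1)[OF eq bc]) (use bc in auto)
    then have 1: "M11 = 0\<^sub>m r1 r2" by (rule quat_mat_eq_minus_self) (rule bc)
    have "M22 = - M22" by (rule four_block_mat_inject(4)[OF eq bc]) (use bc in auto)
    then have 2: "M22 = 0\<^sub>m (n - r1) (n - r2)" by (rule quat_mat_eq_minus_self) (rule bc)
    show ?R using A_M[unfolded M_blocks 1 2] bc(2,3) by (intro bexI)
  next
    assume ?R
    then obtain B C where BC: "B \<in> carrier_mat r1 (n - r2)" "C \<in> carrier_mat (n - r1) r2"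
      and A: "A = U * four_block_mat (0\<^sub>m r1 r2) B C (0\<^sub>m (n - r1) (n - r2)) * conj_transpose V"
      by (elim bexE) (rule that)
    define M where "M = four_block_mat (0\<^sub>m r1 r2) B C (0\<^sub>m (n - r1) (n - r2))"
    have M: "M \<in> carrier_mat n n" 
      using four_block_carrier_mat[of "0\<^sub>m r1 r2" r1 r2 "0\<^sub>m (n - r1) (n - r2)" "n - r1" "n - r2" B C] r
      unfolding M_def by simp
    have "S1 * M * S2 = four_block_mat (0\<^sub>m r1 r2) (- B) (- C) (0\<^sub>m (n - r1) (n - r2))"
      unfolding M_def S1_def S2_def
      by (rule signature_mat_conjugate[OF zero_carrier_mat BC zero_carrier_mat])
    also have "\<dots> = - M" 
      unfolding M_def uminus_four_block_mat[OF zero_carrier_mat BC zero_carrier_mat] by simp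
    finally have "S1 * M * S2 = - M" .
    then have "P * A * Q = - A"
      using PAQ[OF M] Uc Vc M unfolding A M_def[symmetric] by simp
    moreover have "A \<in> carrier_mat n n" unfolding A M_def[symmetric] using Uc Vc
      by (auto intro!: carrier_matI)
    ultimately show "A \<in> gen_antireflexive n P Q" unfolding gen_antireflexive_def by simp
  qed
qed

section \<open>Best approximation under a linear constraint\<close>

text \<open>The matrix \<open>B\<^sub>0\<close> sees \<open>B\<close> only through
  \<open>B * X\<close>, so all \<open>B\<close> with the same product share it.
  \<open>B\<^sub>0 - E\<close> and \<open>B - B\<^sub>0\<close> are the two parts of
  \<open>B - E\<close> cut out by the orthogonal projection \<open>X * G\<close> and its
  complement.\<close>

lemma hermitian_inner_inverse_best_approximation:
  assumes X: "X \<in> carrier_mat n l" and G: "G \<in> carrier_mat l n"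
    and XGX: "X * G * X = X" and herm: "conj_transpose (X * G) = X * G"
    and B: "B \<in> carrier_mat k n" and E: "E \<in> carrier_mat k n"
  defines "B\<^sub>0 \<equiv> B * X * G + E * R_mat X G"
  shows "B\<^sub>0 * X = B * X"
    and "(frob_norm (B - E))\<^sup>2 = (frob_norm (B - B\<^sub>0))\<^sup>2 + (frob_norm (B\<^sub>0 - E))\<^sup>2"
proof -
  define P where "P = X * G"
  have P: "P \<in> carrier_mat n n" using X G by (simp add: P_def)
  have PX: "P * X = X" using XGX unfolding P_def .
  have B0: "B\<^sub>0 = B * P + E * (1\<^sub>m n - P)"
    unfolding B\<^sub>0_def R_mat_def P_def using X G B by (simp add: mult_mat_assoc_dim)
  have "B\<^sub>0 * X = B * (P * X) + E * ((1\<^sub>m n - P) * X)"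
    unfolding B0 using P X B E by (simp add: add_mult_distrib_mat_dim mult_mat_assoc_dim)
  also have "(1\<^sub>m n - P) * X = 0\<^sub>m n l" using P X PX by (simp add: minus_mult_distrib_mat_dim)
  finally show "B\<^sub>0 * X = B * X" using PX X B E by simp
  have "P * P = P * X * G" unfolding P_def using X G by (simp add: mult_mat_assoc_dim)
  then have idem: "P * P = P" using PX P_def by simp
  \<comment> \<open>Naming the products leaves purely additive identities, which are checked
    entrywise.\<close>
  define BP where "BP = B * P"
  define EP where "EP = E * P"
  have BP: "BP \<in> carrier_mat k n" and EP: "EP \<in> carrier_mat k n"
    using B E P by (simp_all add: BP_def EP_def)
  have B0': "B\<^sub>0 = BP + (E - EP)"
    unfolding B0 BP_def EP_def using P E by (simp add: mult_minus_distrib_mat_dim)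
  have "(B - E) * P = BP - EP" and "(B - E) * (1\<^sub>m n - P) = B - E - (BP - EP)"
    unfolding BP_def EP_def using P B E
    by (simp_all add: mult_minus_distrib_mat_dim minus_mult_distrib_mat_dim)
  moreover have "B - (BP + (E - EP)) = B - E - (BP - EP)" and "BP + (E - EP) - E = BP - EP"
    by (rule eq_matI; use B E BP EP in simp)+
  ultimately have eq1: "B - B\<^sub>0 = (B - E) * (1\<^sub>m n - P)" and eq2: "B\<^sub>0 - E = (B - E) * P"
    unfolding B0' by simp_all
  have "B - E \<in> carrier_mat k n" using B E by (intro minus_carrier_mat)
  from frob_norm_pythagoras[OF this P herm[folded P_def] idem]
  show "(frob_norm (B - E))\<^sup>2 = (frob_norm (B - B\<^sub>0))\<^sup>2 + (frob_norm (B\<^sub>0 - E))\<^sup>2"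
    unfolding eq1 eq2 by simp
qed

text \<open>The outer factors pull out of the difference by distributivity, after which both
  isometry lemmas apply.\<close>

lemma frob_norm_unitary_diff:
  assumes U: "unitary_quat_mat n U" and V: "unitary_quat_mat n V"
    and M: "M \<in> carrier_mat n n" and M': "M' \<in> carrier_mat n n"
  shows "frob_norm (U * M * conj_transpose V - U * M' * conj_transpose V) = frob_norm (M - M')"
proof -
  have c: "U \<in> carrier_mat n n" "V \<in> carrier_mat n n"
    and u: "conj_transpose U * U = 1\<^sub>m n" "conj_transpose V * V = 1\<^sub>m n"
    using U V unfolding unitary_quat_mat_def by simp_all
  have "U * M * conj_transpose V - U * M' * conj_transpose V = U * (M - M') * conj_transpose V"
    using c M M' by (simp add: mat_ring_simps)
  also have "frob_norm \<dots> = frob_norm (U * (M - M'))"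
    using c u M' by (intro frob_norm_isometry_right[of _ n]) auto
  also have "\<dots> = frob_norm (M - M')"
    using c u M' by (intro frob_norm_isometry_left[of _ n]) auto
  finally show ?thesis .
qed

text \<open>The identity makes \<open>A\<^sub>0\<close> minimal and puts any other minimiser at
  distance zero from it; common dimensions then turn distance zero into equality.\<close>

lemma is_arg_min_frob_norm_pythagoras:
  assumes A0: "A\<^sub>0 \<in> S"
    and pyth: "\<And>A. A \<in> S \<Longrightarrow>
      (frob_norm (A - E))\<^sup>2 = (frob_norm (A - A\<^sub>0))\<^sup>2 + (frob_norm (A\<^sub>0 - E))\<^sup>2"
    and carrier: "S \<subseteq> carrier_mat nr nc"
  shows "is_arg_min (\<lambda>A. frob_norm (A - E)) (\<lambda>A. A \<in> S) A \<longleftrightarrow> A = A\<^sub>0"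
proof -
  have min: "frob_norm (A\<^sub>0 - E) \<le> frob_norm (A - E)" if "A \<in> S" for A
  proof (rule power2_le_imp_le)
    show "(frob_norm (A\<^sub>0 - E))\<^sup>2 \<le> (frob_norm (A - E))\<^sup>2"
      unfolding pyth[OF that] by simp
  qed simp
  have "is_arg_min (\<lambda>A. frob_norm (A - E)) (\<lambda>A. A \<in> S) A\<^sub>0"
    unfolding is_arg_min_def using A0 min leD by blast
  moreover have "A = A\<^sub>0" if "is_arg_min (\<lambda>A. frob_norm (A - E)) (\<lambda>A. A \<in> S) A"
  proof -
    have A: "A \<in> S" and "\<not> frob_norm (A\<^sub>0 - E) < frob_norm (A - E)"
      using that A0 unfolding is_arg_min_def by auto
    then have "frob_norm (A - E) = frob_norm (A\<^sub>0 - E)" using min[OF A] by simp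
    then have "frob_norm (A - A\<^sub>0) = 0" using pyth[OF A] by simp
    moreover have c: "A \<in> carrier_mat nr nc" "A\<^sub>0 \<in> carrier_mat nr nc" using A A0 carrier by blast+
    ultimately have z: "A - A\<^sub>0 = 0\<^sub>m nr nc" by (intro frob_norm_eq_0 minus_carrier_mat)
    show "A = A\<^sub>0"
    proof (rule eq_matI)
      fix i j assume ij: "i < dim_row A\<^sub>0" "j < dim_col A\<^sub>0"
      have "(A - A\<^sub>0) $$ (i, j) = 0" unfolding z using ij c by simp
      then show "A $$ (i, j) = A\<^sub>0 $$ (i, j)" using ij by simp
    qed (use c in simp_all)
  qed
  ultimately show ?thesis by blast
qed

section \<open>The constrained approximation problem\<close>

text \<open>The Hermitian conditions say that \<open>X1 * X1p\<close> and \<open>X2 * X2p\<close>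
  are orthogonal projections. With oblique ones the displayed matrix still lies in the constraint
  set, but the Pythagorean splitting is lost and it can fail to be closest to
  \<open>E\<close>.\<close>

theorem theorem3p4:
  fixes n m l r1 r2 :: nat
    and P Q U U1 U2 V V1 V2 Z X1 X2 Y1 Y2 \<Lambda> \<Phi> \<Psi> E E11 E12 E21 E22 X1p X2p :: "quat mat"
    and lam :: "nat \<Rightarrow> complex"
  assumes P: "nontrivial_gen_reflection n P" and Q: "nontrivial_gen_reflection n Q"
    and r1: "r1 \<le> n" and r2: "r2 \<le> n"
    and U1: "U1 \<in> carrier_mat n r1" and U2: "U2 \<in> carrier_mat n (n - r1)"
    and V1: "V1 \<in> carrier_mat n r2" and V2: "V2 \<in> carrier_mat n (n - r2)"
    and U: "U = append_cols U1 U2" "unitary_quat_mat n U"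
    and V: "V = append_cols V1 V2" "unitary_quat_mat n V"
    and P_decomp: "P = U * signature_mat r1 (n - r1) * conj_transpose U"
    and Q_decomp: "Q = V * signature_mat r2 (n - r2) * conj_transpose V"
    and Z: "Z \<in> carrier_mat n m"
    and lam: "\<forall>i<m. Im (lam i) \<ge> 0"
    and \<Lambda>: "\<Lambda> = complex_diag m lam"
    and l: "0 < l" "l < m"
    and X1: "X1 \<in> carrier_mat (n - r2) l" and X2: "X2 \<in> carrier_mat r2 (m - l)"
    and Y1: "Y1 \<in> carrier_mat r1 l" and Y2: "Y2 \<in> carrier_mat (n - r1) (m - l)"
    and Z_X: "Z = append_cols (V2 * X1) (V1 * X2)"
    and Z_Y: "Z = append_cols (U1 * Y1) (U2 * Y2)"
    and \<Phi>: "\<Phi> = complex_diag l lam"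
    and \<Psi>: "\<Psi> = complex_diag (m - l) (\<lambda>i. lam (l + i))"
    and \<Lambda>_blocks: "\<Lambda> = four_block_mat \<Phi> (0\<^sub>m l (m - l)) (0\<^sub>m (m - l) l) \<Psi>"
    and nonempty: "phi2 n P Q Z \<Lambda> \<noteq> {}"
    and E: "E \<in> carrier_mat n n"
    and E11: "E11 \<in> carrier_mat r1 r2" and E12: "E12 \<in> carrier_mat r1 (n - r2)"
    and E21: "E21 \<in> carrier_mat (n - r1) r2" and E22: "E22 \<in> carrier_mat (n - r1) (n - r2)"
    and E_blocks: "append_rows (conj_transpose U1) (conj_transpose U2) * E * append_cols V1 V2
                     = four_block_mat E11 E12 E21 E22"
    and X1p: "reflexive_inverse X1 X1p" and X2p: "reflexive_inverse X2 X2p"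
  shows "(\<exists>!A. is_arg_min (\<lambda>A. frob_norm (A - E)) (\<lambda>A. A \<in> phi2 n P Q Z \<Lambda>) A) \<and>
    (conj_transpose (X1 * X1p) = X1 * X1p \<and> conj_transpose (X2 * X2p) = X2 * X2p \<longrightarrow>
      is_arg_min (\<lambda>A. frob_norm (A - E)) (\<lambda>A. A \<in> phi2 n P Q Z \<Lambda>)
        (append_cols U1 U2
         * four_block_mat (0\<^sub>m r1 r2) (Y1 * \<Phi> * X1p + E12 * R_mat X1 X1p)
                          (Y2 * \<Psi> * X2p + E21 * R_mat X2 X2p) (0\<^sub>m (n - r1) (n - r2))
         * append_rows (conj_transpose V1) (conj_transpose V2)))"
proof -
  define W where "W B C = U * four_block_mat (0\<^sub>m r1 r2) B C (0\<^sub>m (n - r1) (n - r2)) * conj_transpose V"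
    for B C
  \<comment> \<open>Keeping the inner inverses as parameters allows two uses: with the Gram-Schmidt
    ones for existence and with the prescribed ones for the formula.\<close>
  define opt where "opt G1 G2 = W (Y1 * \<Phi> * G1 + E12 * R_mat X1 G1) (Y2 * \<Psi> * G2 + E21 * R_mat X2 G2)"
    for G1 G2
  have Uc: "U \<in> carrier_mat n n" and Vc: "V \<in> carrier_mat n n"
    using U V unfolding unitary_quat_mat_def by simp_all
  have \<Phi>c: "\<Phi> \<in> carrier_mat l l" and \<Psi>c: "\<Psi> \<in> carrier_mat (m - l) (m - l)"
    unfolding \<Phi> \<Psi> complex_diag_def by simp_all
  have block_carrier: "four_block_mat A B C D \<in> carrier_mat n n"
    if "A \<in> carrier_mat r1 r2" "D \<in> carrier_mat (n - r1) (n - r2)" for A B C D :: "quat mat"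
    using four_block_carrier_mat[OF that, of B C] r1 r2 by simp
  \<comment> \<open>The first columns of \<open>Z\<close> involve \<open>V2\<close> and the last
    ones \<open>V1\<close>, so the coordinates with respect to \<open>V\<close> are block
    antidiagonal; those with respect to \<open>U\<close> are block diagonal.\<close>
  have Z_V: "Z = V * four_block_mat (0\<^sub>m r2 l) X2 X1 (0\<^sub>m (n - r2) (m - l))"
    unfolding V(1) Z_X using V1 V2 X1 X2
    by (subst append_cols_mult_four_block[of _ n r2 _ "n - r2" _ l _ "m - l"]) auto
  have Z_U: "Z = U * four_block_mat Y1 (0\<^sub>m r1 (m - l)) (0\<^sub>m (n - r1) l) Y2"
    unfolding U(1) Z_Y using U1 U2 Y1 Y2
    by (subst append_cols_mult_four_block[of _ n r1 _ "n - r1" _ l _ "m - l"]) auto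
  have W_iff: "W B C * Z = Z * \<Lambda> \<longleftrightarrow> B * X1 = Y1 * \<Phi> \<and> C * X2 = Y2 * \<Psi>"
    if B: "B \<in> carrier_mat r1 (n - r2)" and C: "C \<in> carrier_mat (n - r1) r2" for B C
  proof -
    define M where "M = four_block_mat (0\<^sub>m r1 r2) B C (0\<^sub>m (n - r1) (n - r2))"
    define N where "N = four_block_mat (0\<^sub>m r2 l) X2 X1 (0\<^sub>m (n - r2) (m - l))"
    define L where "L = four_block_mat (B * X1) (0\<^sub>m r1 (m - l)) (0\<^sub>m (n - r1) l) (C * X2)"
    define R where "R = four_block_mat (Y1 * \<Phi>) (0\<^sub>m r1 (m - l)) (0\<^sub>m (n - r1) l) (Y2 * \<Psi>)"
    have M: "M \<in> carrier_mat n n" unfolding M_def by (rule block_carrier) auto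
    have N: "dim_row N = n" unfolding N_def using r2 by simp
    have L: "dim_row L = n" and R: "dim_row R = n" unfolding L_def R_def using B C Y1 Y2 r1 by simp_all
    have "W B C * Z = U * (M * (conj_transpose V * (V * N)))"
      unfolding W_def Z_V M_def[symmetric] N_def[symmetric] using Uc Vc M N
      by (simp add: mult_mat_assoc_dim)
    also have "\<dots> = U * (M * N)" using unitary_cancel(1)[OF V(2) N] by simp
    \<comment> \<open>An antidiagonal matrix times an antidiagonal one is block diagonal, which
      separates the two unknown blocks.\<close>
    also have "M * N = L"
      unfolding M_def N_def L_def
      by (subst mult_four_block_mat[of _ r1 r2 _ "n - r2" _ "n - r1" _ _ l _ "m - l"])
        (use B C X1 X2 in auto)
    finally have 1: "W B C * Z = U * L" .
    define T where "T = four_block_mat Y1 (0\<^sub>m r1 (m - l)) (0\<^sub>m (n - r1) l) Y2"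
    have T: "T \<in> carrier_mat n m" unfolding T_def using Y1 Y2 r1 l by (intro carrier_matI) simp_all
    have \<Lambda>c: "\<Lambda> \<in> carrier_mat m m" unfolding \<Lambda> complex_diag_def by simp
    have "Z * \<Lambda> = U * (T * \<Lambda>)"
      unfolding Z_U T_def[symmetric] using Uc T \<Lambda>c by (simp add: mult_mat_assoc_dim)
    also have "T * \<Lambda> = R"
      unfolding T_def \<Lambda>_blocks R_def
      by (subst mult_four_block_mat[of _ r1 l _ "m - l" _ "n - r1" _ _ l _ "m - l"])
        (use Y1 Y2 \<Phi>c \<Psi>c in auto)
    finally have 2: "Z * \<Lambda> = U * R" .
    \<comment> \<open>Left multiplication by a unitary matrix is injective.\<close>
    have "W B C * Z = Z * \<Lambda> \<longleftrightarrow> L = R"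
      unfolding 1 2 using unitary_cancel(1)[OF U(2) L] unitary_cancel(1)[OF U(2) R] by metis
    also have "\<dots> \<longleftrightarrow> B * X1 = Y1 * \<Phi> \<and> C * X2 = Y2 * \<Psi>"
    proof
      assume "L = R"
      from four_block_mat_inject[OF this[unfolded L_def R_def],
          of r1 l "m - l" "n - r1"]
      show "B * X1 = Y1 * \<Phi> \<and> C * X2 = Y2 * \<Psi>" using B C X1 X2 Y1 Y2 \<Phi>c \<Psi>c by simp
    qed (simp add: L_def R_def)
    finally show ?thesis .
  qed
  have phi2_iff: "A \<in> phi2 n P Q Z \<Lambda> \<longleftrightarrow>
      (\<exists>B \<in> carrier_mat r1 (n - r2). \<exists>C \<in> carrier_mat (n - r1) r2.
        A = W B C \<and> B * X1 = Y1 * \<Phi> \<and> C * X2 = Y2 * \<Psi>)" for A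
    unfolding phi2_def mem_Collect_eq
      gen_antireflexive_block_iff[OF U(2) V(2) r1 r2 P_decomp Q_decomp] W_def[symmetric]
    using W_iff by blast
  have W_diff: "(frob_norm (W B C - W B' C'))\<^sup>2 = (frob_norm (B - B'))\<^sup>2 + (frob_norm (C - C'))\<^sup>2"
    if "B \<in> carrier_mat r1 (n - r2)" "C \<in> carrier_mat (n - r1) r2"
      "B' \<in> carrier_mat r1 (n - r2)" "C' \<in> carrier_mat (n - r1) r2" for B C B' C'
  proof -
    have zero: "(frob_norm (0\<^sub>m a b))\<^sup>2 = 0" for a b
      unfolding frob_norm_sq by (simp add: quat_defs)
    have "frob_norm (W B C - W B' C')
        = frob_norm (four_block_mat (0\<^sub>m r1 r2) B C (0\<^sub>m (n - r1) (n - r2))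
            - four_block_mat (0\<^sub>m r1 r2) B' C' (0\<^sub>m (n - r1) (n - r2)))"
      unfolding W_def by (rule frob_norm_unitary_diff[OF U(2) V(2)]; rule block_carrier; simp)
    also have "\<dots> = frob_norm (four_block_mat (0\<^sub>m r1 r2) (B - B') (C - C') (0\<^sub>m (n - r1) (n - r2)))"
      using that
      by (subst minus_four_block_mat) (auto simp: minus_r_inv_mat[OF zero_carrier_mat])
    also have "\<dots>\<^sup>2 = (frob_norm (B - B'))\<^sup>2 + (frob_norm (C - C'))\<^sup>2"
      using that
      by (subst frob_norm_four_block[of _ r1 r2 _ "n - r2" _ "n - r1"]) (simp_all add: zero minus_carrier_mat)
    finally show ?thesis .
  qed
  define F where "F = four_block_mat E11 E12 E21 E22"
  have Fc: "F \<in> carrier_mat n n" unfolding F_def using E11 E22 by (rule block_carrier)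
  have E_F: "E = U * F * conj_transpose V"
  proof -
    have "F = conj_transpose U * E * V"
      using E_blocks U1 U2 unfolding F_def U(1) V(1) by (simp add: append_rows_conj_transpose)
    moreover have "V * conj_transpose V = 1\<^sub>m n" using V(2) by (simp add: unitary_quat_mat_def)
    ultimately show ?thesis
      using Uc Vc E U(2) by (simp add: mult_mat_assoc_dim unitary_cancel)
  qed
  \<comment> \<open>The contribution of the blocks \<open>E11\<close> and \<open>E22\<close>, which
    no choice of \<open>B\<close> and \<open>C\<close> can influence.\<close>
  define \<epsilon> where "\<epsilon> = (frob_norm (0\<^sub>m r1 r2 - E11))\<^sup>2 + (frob_norm (0\<^sub>m (n - r1) (n - r2) - E22))\<^sup>2"
  have W_E: "(frob_norm (W B C - E))\<^sup>2 = \<epsilon> + (frob_norm (B - E12))\<^sup>2 + (frob_norm (C - E21))\<^sup>2"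
    if BC: "B \<in> carrier_mat r1 (n - r2)" "C \<in> carrier_mat (n - r1) r2" for B C
  proof -
    have "frob_norm (W B C - E)
        = frob_norm (four_block_mat (0\<^sub>m r1 r2) B C (0\<^sub>m (n - r1) (n - r2)) - F)"
      unfolding W_def E_F
      by (rule frob_norm_unitary_diff[OF U(2) V(2) block_carrier Fc]) simp_all
    also have "\<dots> = frob_norm (four_block_mat (0\<^sub>m r1 r2 - E11) (B - E12) (C - E21)
        (0\<^sub>m (n - r1) (n - r2) - E22))"
      unfolding F_def using BC E11 E12 E21 E22 by (subst minus_four_block_mat) auto
    also have "\<dots>\<^sup>2 = \<epsilon> + (frob_norm (B - E12))\<^sup>2 + (frob_norm (C - E21))\<^sup>2"
      unfolding \<epsilon>_def using E11 E12 E21 E22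
      by (subst frob_norm_four_block[of _ r1 r2 _ "n - r2" _ "n - r1"]) (simp_all add: minus_carrier_mat)
    finally show ?thesis .
  qed
  have phi2_carrier: "phi2 n P Q Z \<Lambda> \<subseteq> carrier_mat n n"
    unfolding phi2_def gen_antireflexive_def by auto
  \<comment> \<open>Every pair of Hermitian inner inverses characterises the minimisers in the same
    way, so all such pairs give the same matrix.\<close>
  have opt: "is_arg_min (\<lambda>A. frob_norm (A - E)) (\<lambda>A. A \<in> phi2 n P Q Z \<Lambda>) A \<longleftrightarrow> A = opt G1 G2"
    if G1: "G1 \<in> carrier_mat l (n - r2)" "X1 * G1 * X1 = X1" "conj_transpose (X1 * G1) = X1 * G1"
      and G2: "G2 \<in> carrier_mat (m - l) r2" "X2 * G2 * X2 = X2" "conj_transpose (X2 * G2) = X2 * G2"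
    for A G1 G2
  proof (rule is_arg_min_frob_norm_pythagoras[OF _ _ phi2_carrier])
    define B\<^sub>0 where "B\<^sub>0 = Y1 * \<Phi> * G1 + E12 * R_mat X1 G1"
    define C\<^sub>0 where "C\<^sub>0 = Y2 * \<Psi> * G2 + E21 * R_mat X2 G2"
    have B0c: "B\<^sub>0 \<in> carrier_mat r1 (n - r2)" and C0c: "C\<^sub>0 \<in> carrier_mat (n - r1) r2"
      unfolding B\<^sub>0_def C\<^sub>0_def R_mat_def using X1 X2 G1(1) G2(1) E12 E21
      by (auto intro!: carrier_matI)
    have opt_W: "opt G1 G2 = W B\<^sub>0 C\<^sub>0" unfolding opt_def B\<^sub>0_def C\<^sub>0_def ..
    have proj: "B\<^sub>0 * X1 = Y1 * \<Phi>" "C\<^sub>0 * X2 = Y2 * \<Psi>"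
        "(frob_norm (B - E12))\<^sup>2 = (frob_norm (B - B\<^sub>0))\<^sup>2 + (frob_norm (B\<^sub>0 - E12))\<^sup>2"
        "(frob_norm (C - E21))\<^sup>2 = (frob_norm (C - C\<^sub>0))\<^sup>2 + (frob_norm (C\<^sub>0 - E21))\<^sup>2"
      if B: "B \<in> carrier_mat r1 (n - r2)" "B * X1 = Y1 * \<Phi>"
        and C: "C \<in> carrier_mat (n - r1) r2" "C * X2 = Y2 * \<Psi>" for B C
      using hermitian_inner_inverse_best_approximation[OF X1 G1 B(1) E12]
        hermitian_inner_inverse_best_approximation[OF X2 G2 C(1) E21]
      unfolding B(2) C(2) B\<^sub>0_def C\<^sub>0_def by simp_all
    \<comment> \<open>Solvability enters here: \<open>B\<^sub>0 * X1\<close> reduces to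
      \<open>Y1 * \<Phi>\<close> because the latter is \<open>B * X1\<close> for some
      \<open>B\<close>; similarly for the other block.\<close>
    from nonempty obtain B C where "B \<in> carrier_mat r1 (n - r2)" "B * X1 = Y1 * \<Phi>"
        "C \<in> carrier_mat (n - r1) r2" "C * X2 = Y2 * \<Psi>"
      using phi2_iff by blast
    from proj(1,2)[OF this] show "opt G1 G2 \<in> phi2 n P Q Z \<Lambda>"
      unfolding opt_W phi2_iff using B0c C0c by blast
    fix A assume "A \<in> phi2 n P Q Z \<Lambda>"
    then obtain B C where BC: "B \<in> carrier_mat r1 (n - r2)" "B * X1 = Y1 * \<Phi>"
        "C \<in> carrier_mat (n - r1) r2" "C * X2 = Y2 * \<Psi>" and A: "A = W B C"
      unfolding phi2_iff by blast
    \<comment> \<open>The splittings of the two blocks add up, and the constant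
      \<open>\<epsilon>\<close> appears once on each side.\<close>
    show "(frob_norm (A - E))\<^sup>2 = (frob_norm (A - opt G1 G2))\<^sup>2 + (frob_norm (opt G1 G2 - E))\<^sup>2"
      unfolding A opt_W W_diff[OF BC(1,3) B0c C0c] W_E[OF BC(1,3)] W_E[OF B0c C0c]
        proj(3,4)[OF BC]
      by simp
  qed
  \<comment> \<open>Existence and uniqueness rest on these constructed inverses, independently of
    the prescribed \<open>X1p\<close> and \<open>X2p\<close>.\<close>
  obtain G1 where G1: "G1 \<in> carrier_mat l (n - r2)" "X1 * G1 * X1 = X1"
      "conj_transpose (X1 * G1) = X1 * G1"
    using exists_hermitian_inner_inverse[OF X1] by blast
  obtain G2 where G2: "G2 \<in> carrier_mat (m - l) r2" "X2 * G2 * X2 = X2"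
      "conj_transpose (X2 * G2) = X2 * G2"
    using exists_hermitian_inner_inverse[OF X2] by blast
  have "\<exists>!A. is_arg_min (\<lambda>A. frob_norm (A - E)) (\<lambda>A. A \<in> phi2 n P Q Z \<Lambda>) A"
    unfolding opt[OF G1 G2] by simp
  moreover have "is_arg_min (\<lambda>A. frob_norm (A - E)) (\<lambda>A. A \<in> phi2 n P Q Z \<Lambda>) (opt X1p X2p)"
    if "conj_transpose (X1 * X1p) = X1 * X1p" "conj_transpose (X2 * X2p) = X2 * X2p"
    using X1p X2p X1 X2 that unfolding reflexive_inverse_def by (subst opt) auto
  moreover have "append_rows (conj_transpose V1) (conj_transpose V2) = conj_transpose V"
    using V1 V2 unfolding V(1) by (simp add: append_rows_conj_transpose)
  ultimately show ?thesis
    unfolding opt_def W_def U(1) by simp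
qed

end
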